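(* For $\mu=0$, formulation $(AMS_\mu)$ is equivalent to the two-stage stochastic programming formulation $(2SP)$. For $\mu=T-1$, formulation $(AMS_\mu)$ is equivalent to the multistage stochastic programming formulation $(MSP)$.
   Context: A scenario tree $\mathcal{T}$ has $T$ stages, $\mathcal{P}=\{1,\dots,T\}$; every non-leaf node has $B$ children. $S_t$ is the set of nodes of stage $t$, $P(n)$ is the set of nodes on the path from the root to $n$ (inclusive), and $\mathcal{T}(l)$ is the subtree rooted at node $l$. Node $n$ has probability $p_n$, with $\sum_{n\in S_t}p_n=1$ for each $t$. At each node $n$ there are state variables $\mathbf{x}_n=(x_{1n},\dots,x_{In})$ and stage variables $\mathbf{y}_n=(y_{1n},\dots,y_{Jn})$ (integer or continuous); $\mathcal{I}=\{1,\dots,I\}$. Data: $\mathbf{a}_n,\mathbf{b}_n,\mathbf{C}_{nm},\mathbf{D}_n,\mathbf{d}_n$ and local sets $\mathcal{X}_n,\mathcal{Y}_n$. State variables satisfy $0\le x_{in}\le\bar{x}_i$, where $\bar{x}_i$ is a given upper bound; these bounds are implied by $\mathbf{x}_n\in\mathcal{X}_n$. $(MSP)$: minimize $\sum_{n\in\mathcal{T}}p_n(\mathbf{a}_n^\top\mathbf{x}_n+\mathbf{b}_n^\top\mathbf{y}_n)$ over $(\mathbf{x},\mathbf{y})$ subject to (A) $\sum_{m\in P(n)}\mathbf{C}_{nm}\mathbf{x}_m+\mathbf{D}_n\mathbf{y}_n\ge\mathbf{d}_n$ for all $n\in\mathcal{T}$; (B) $\mathbf{x}_n\in\mathcal{X}_n,\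 \mathbf{y}_n\in\mathcal{Y}_n$ for all $n\in\mathcal{T}$. $(2SP)$: same objective and constraints (A), (B), plus $\mathbf{x}_m=\mathbf{x}_n$ for all $m,n\in S_t$, $t\in\mathcal{P}$. $(AMS_\mu)$, for $\mu\in\{0,\dots,T-1\}$: same objective, minimized over $(\mathbf{x},\mathbf{y},\mathbf{r})$ subject to (A), (B), and (C) $x_{im}\ge x_{in}-\bar{x}_i(r_{it'}-r_{it})$ and $x_{im}\le x_{in}+\bar{x}_i(r_{it'}-r_{it})$ for all $m,n\in S_{t'}\cap\mathcal{T}(l)$, $l\in S_t$, $t'\ge t$, $t,t'\in\mathcal{P}$, $i\in\mathcal{I}$; (D) $r_{i1}\le r_{i2}\le\dots\le r_{iT}\le\mu$; $r_{i(t+1)}-r_{it}\le1$ for $t\in\{1,\dots,T-1\}$; $r_{i1}=0$; $r_{it}\in\mathbb{Z}_{+}$, for all $i\in\mathcal{I}$, $t\in\mathcal{P}$. Two formulations with this same objective are called equivalent if the same pairs $(\mathbf{x},\mathbf{y})$ are feasible for both (for $(AMS_\mu)$: feasible together with some $\mathbf{r}$); hence they have the same optimal value. *)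

theory Defs
  imports "Jordan_Normal_Form.Matrix" "HOL-Library.Extended_Real"
begin

text \<open>The value of \<open>parent\<close> at the root is irrelevant. Stages are numbered from \<open>1\<close> (the root)
  to \<open>horizon\<close> (the leaves).\<close>

record 'v scenario_tree =
  nodes :: "'v set"
  root :: 'v
  parent :: "'v \<Rightarrow> 'v"
  stage :: "'v \<Rightarrow> nat"
  horizon :: nat
  branching :: nat

definition arcs :: "('v, 'z) scenario_tree_scheme \<Rightarrow> ('v \<times> 'v) set" where
  "arcs \<T> = {(parent \<T> n, n) | n. n \<in> nodes \<T> \<and> n \<noteq> root \<T>}"

definition children :: "('v, 'z) scenario_tree_scheme \<Rightarrow> 'v \<Rightarrow> 'v set" where
  "children \<T> n = {c. (n, c) \<in> arcs \<T>}"

definition stage_nodes :: "('v, 'z) scenario_tree_scheme \<Rightarrow> nat \<Rightarrow> 'v set" where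
  "stage_nodes \<T> t = {n \<in> nodes \<T>. stage \<T> n = t}"

text \<open>For a node \<open>n\<close> of a scenario tree these are the nodes on the path from the root to \<open>n\<close>, both
  included.\<close>

definition path_nodes :: "('v, 'z) scenario_tree_scheme \<Rightarrow> 'v \<Rightarrow> 'v set" where
  "path_nodes \<T> n = {m. (m, n) \<in> (arcs \<T>)\<^sup>*}"

definition subtree_nodes :: "('v, 'z) scenario_tree_scheme \<Rightarrow> 'v \<Rightarrow> 'v set" where
  "subtree_nodes \<T> l = {n. (l, n) \<in> (arcs \<T>)\<^sup>*}"

text \<open>Since \<open>stage\<close> decreases strictly from a node to its parent, following parents from any node
  ends in the root, so the arcs form a rooted tree and \<open>stage\<close> is one plus the depth. A non-leaf
  is a node before the last stage.\<close>

definition is_scenario_tree :: "('v, 'z) scenario_tree_scheme \<Rightarrow> bool" where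
  "is_scenario_tree \<T> \<longleftrightarrow>
     horizon \<T> \<ge> 1 \<and> branching \<T> \<ge> 1 \<and> finite (nodes \<T>) \<and>
     root \<T> \<in> nodes \<T> \<and> stage \<T> (root \<T>) = 1 \<and>
     (\<forall>n \<in> nodes \<T>. n \<noteq> root \<T> \<longrightarrow>
        parent \<T> n \<in> nodes \<T> \<and> stage \<T> n = Suc (stage \<T> (parent \<T> n))) \<and>
     (\<forall>n \<in> nodes \<T>. stage \<T> n \<le> horizon \<T>) \<and>
     (\<forall>n \<in> nodes \<T>. stage \<T> n < horizon \<T> \<longrightarrow> card (children \<T> n) = branching \<T>)"

text \<open>The number of rows of the linear constraints may depend on the node. The local sets
  \<open>Xset n\<close> and \<open>Yset n\<close> are arbitrary, so they also carry any integrality requirements.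
  Components of vectors are indexed from \<open>0\<close>.\<close>

record 'v msp_instance = "'v scenario_tree" +
  prob :: "'v \<Rightarrow> real"
  xdim :: nat
  ydim :: nat
  rows :: "'v \<Rightarrow> nat"
  xcost :: "'v \<Rightarrow> real vec"
  ycost :: "'v \<Rightarrow> real vec"
  Cmat :: "'v \<Rightarrow> 'v \<Rightarrow> real mat"
  Dmat :: "'v \<Rightarrow> real mat"
  drhs :: "'v \<Rightarrow> real vec"
  Xset :: "'v \<Rightarrow> real vec set"
  Yset :: "'v \<Rightarrow> real vec set"
  xbar :: "real vec"

definition is_msp_instance :: "'v msp_instance \<Rightarrow> bool" where
  "is_msp_instance M \<longleftrightarrow>
     is_scenario_tree M \<and>
     (\<forall>n \<in> nodes M. prob M n \<ge> 0) \<and>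
     (\<forall>t \<in> {1..horizon M}. (\<Sum>n \<in> stage_nodes M t. prob M n) = 1) \<and>
     (\<forall>n \<in> nodes M.
        xcost M n \<in> carrier_vec (xdim M) \<and>
        ycost M n \<in> carrier_vec (ydim M) \<and>
        (\<forall>m \<in> path_nodes M n. Cmat M n m \<in> carrier_mat (rows M n) (xdim M)) \<and>
        Dmat M n \<in> carrier_mat (rows M n) (ydim M) \<and>
        drhs M n \<in> carrier_vec (rows M n) \<and>
        Xset M n \<subseteq> carrier_vec (xdim M) \<and>
        Yset M n \<subseteq> carrier_vec (ydim M)) \<and>
     xbar M \<in> carrier_vec (xdim M) \<and>
     (\<forall>n \<in> nodes M. \<forall>v \<in> Xset M n. \<forall>i < xdim M. 0 \<le> v $ i \<and> v $ i \<le> xbar M $ i)"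

record 'a formulation =
  objective :: "'a \<Rightarrow> real"
  feasible :: "'a set"

text \<open>The value is \<open>\<infinity>\<close> for an infeasible and \<open>-\<infinity>\<close> for an unbounded formulation.\<close>

definition optimal_value :: "'a formulation \<Rightarrow> ereal" where
  "optimal_value F = (INF z \<in> feasible F. ereal (objective F z))"

text \<open>The auxiliary decisions \<open>r\<close> of \<open>F\<close> are projected out.\<close>

definition equivalent :: "('a \<times> 'r) formulation \<Rightarrow> 'a formulation \<Rightarrow> bool" where
  "equivalent F G \<longleftrightarrow>
     (\<forall>z r. objective F (z, r) = objective G z) \<and>
     (\<forall>z. (\<exists>r. (z, r) \<in> feasible F) \<longleftrightarrow> z \<in> feasible G)"

text \<open>Decisions are functions on the whole type of nodes; values outside \<open>nodes M\<close> are unconstrained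
  and do not enter the objective.\<close>

type_synonym 'v decision = "('v \<Rightarrow> real vec) \<times> ('v \<Rightarrow> real vec)"

definition expected_cost :: "'v msp_instance \<Rightarrow> 'v decision \<Rightarrow> real" where
  "expected_cost M = (\<lambda>(x, y).
     \<Sum>n \<in> nodes M. prob M n * (xcost M n \<bullet> x n + ycost M n \<bullet> y n))"

definition linking_constraints :: "'v msp_instance \<Rightarrow> 'v decision \<Rightarrow> bool" where
  "linking_constraints M = (\<lambda>(x, y). \<forall>n \<in> nodes M.
     finsum_vec TYPE(real) (rows M n) (\<lambda>m. Cmat M n m *\<^sub>v x m) (path_nodes M n)
       + Dmat M n *\<^sub>v y n \<ge> drhs M n)"

definition local_constraints :: "'v msp_instance \<Rightarrow> 'v decision \<Rightarrow> bool" where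
  "local_constraints M = (\<lambda>(x, y). \<forall>n \<in> nodes M. x n \<in> Xset M n \<and> y n \<in> Yset M n)"

definition MSP :: "'v msp_instance \<Rightarrow> 'v decision formulation" where
  "MSP M = \<lparr> objective = expected_cost M,
     feasible = {(x, y). linking_constraints M (x, y) \<and> local_constraints M (x, y)} \<rparr>"

definition two_stage_constraints :: "'v msp_instance \<Rightarrow> ('v \<Rightarrow> real vec) \<Rightarrow> bool" where
  "two_stage_constraints M x \<longleftrightarrow>
     (\<forall>t \<in> {1..horizon M}. \<forall>m \<in> stage_nodes M t. \<forall>n \<in> stage_nodes M t. x m = x n)"

definition TSP :: "'v msp_instance \<Rightarrow> 'v decision formulation" where
  "TSP M = \<lparr> objective = expected_cost M,
     feasible = {(x, y). linking_constraints M (x, y) \<and> local_constraints M (x, y) \<and>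
       two_stage_constraints M x} \<rparr>"

definition adaptive_constraints ::
  "'v msp_instance \<Rightarrow> ('v \<Rightarrow> real vec) \<Rightarrow> (nat \<Rightarrow> nat \<Rightarrow> int) \<Rightarrow> bool" where
  "adaptive_constraints M x r \<longleftrightarrow>
     (\<forall>i < xdim M. \<forall>t \<in> {1..horizon M}. \<forall>t' \<in> {t..horizon M}. \<forall>l \<in> stage_nodes M t.
        \<forall>m \<in> stage_nodes M t' \<inter> subtree_nodes M l. \<forall>n \<in> stage_nodes M t' \<inter> subtree_nodes M l.
          x m $ i \<ge> x n $ i - xbar M $ i * of_int (r i t' - r i t) \<and>
          x m $ i \<le> x n $ i + xbar M $ i * of_int (r i t' - r i t))"

definition revision_constraints ::
  "'v msp_instance \<Rightarrow> nat \<Rightarrow> (nat \<Rightarrow> nat \<Rightarrow> int) \<Rightarrow> bool" where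
  "revision_constraints M \<mu> r \<longleftrightarrow>
     (\<forall>i < xdim M.
        (\<forall>t \<in> {1..<horizon M}. r i t \<le> r i (t + 1)) \<and> r i (horizon M) \<le> int \<mu> \<and>
        (\<forall>t \<in> {1..<horizon M}. r i (t + 1) - r i t \<le> 1) \<and>
        r i 1 = 0 \<and>
        (\<forall>t \<in> {1..horizon M}. r i t \<ge> 0))"

definition AMS ::
  "'v msp_instance \<Rightarrow> nat \<Rightarrow> ('v decision \<times> (nat \<Rightarrow> nat \<Rightarrow> int)) formulation" where
  "AMS M \<mu> = \<lparr> objective = (\<lambda>((x, y), r). expected_cost M (x, y)),
     feasible = {((x, y), r). linking_constraints M (x, y) \<and> local_constraints M (x, y) \<and>
       adaptive_constraints M x r \<and> revision_constraints M \<mu> r} \<rparr>"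

end

theory Submission imports Defs begin

text \<open>For \<open>\<mu> = 0\<close> every \<open>r\<close> vanishes, and the adaptive constraints for the subtree of the
  root force all states of a stage to coincide. For \<open>\<mu> = T - 1\<close> choose \<open>r\<^sub>i\<^sub>t = t - 1\<close>: for
  \<open>t' > t\<close> the slack is at least the upper bound of the state, so the constraint follows from the
  bounds, and for \<open>t' = t\<close> the subtree of \<open>l\<close> meets the stage of \<open>l\<close> only in \<open>l\<close>.\<close>

text \<open>Projecting out the auxiliary decisions maps \<open>feasible F\<close> onto
  \<open>feasible G\<close> and preserves the objective, so both infima range over the same set of
  values.\<close>

lemma optimal_value_eq_if_equivalent:
  assumes "equivalent F G"
  shows "optimal_value F = optimal_value G"
proof -
  have "objective F w = objective G (fst w)" for w
    using assms by (cases w) (simp add: equivalent_def)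
  moreover have "feasible G = fst ` feasible F"
    using assms by (force simp: equivalent_def)
  ultimately show ?thesis
    by (simp add: optimal_value_def image_image)
qed

text \<open>Makes the subtree of the root the whole tree, so that the adaptive constraints at the
  root compare any two nodes of a stage.\<close>

lemma root_reaches_node:
  assumes tree: "is_scenario_tree \<T>" and "n \<in> nodes \<T>"
  shows "(root \<T>, n) \<in> (arcs \<T>)\<^sup>*"
  using \<open>n \<in> nodes \<T>\<close>
proof (induction n rule: measure_induct_rule[of "stage \<T>"])
  case (less n)
  show ?case
  proof (cases "n = root \<T>")
    case False
    then have "parent \<T> n \<in> nodes \<T>" "stage \<T> (parent \<T> n) < stage \<T> n"
      using tree less.prems by (auto simp: is_scenario_tree_def)
    moreover have "(parent \<T> n, n) \<in> arcs \<T>"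
      using False less.prems by (auto simp: arcs_def)
    ultimately show ?thesis
      using less.IH by (meson rtrancl.rtrancl_into_rtrancl)
  qed simp
qed

lemma stage_less_if_trancl_arcs:
  assumes "is_scenario_tree \<T>" and "(l, n) \<in> (arcs \<T>)\<^sup>+"
  shows "stage \<T> l < stage \<T> n"
  using assms(2)
proof (induction rule: trancl_induct)
  case (base n)
  then show ?case using assms(1) by (auto simp: arcs_def is_scenario_tree_def)
next
  case (step m n)
  then have "stage \<T> n = Suc (stage \<T> m)"
    using assms(1) by (auto simp: arcs_def is_scenario_tree_def)
  with step.IH show ?case by simp
qed

text \<open>A nonempty path strictly raises the stage, so only the empty path is left.\<close>

lemma subtree_node_same_stage:
  assumes "is_scenario_tree \<T>" and "n \<in> subtree_nodes \<T> l" and "stage \<T> n = stage \<T> l"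
  shows "n = l"
  using assms stage_less_if_trancl_arcs[of \<T> l n]
  by (auto simp: subtree_nodes_def rtrancl_eq_or_trancl)

text \<open>Monotonicity up to the horizon squeezes \<open>r i t\<close> between 0 and the bound
  \<mu> = 0.\<close>

lemma revision_constraints_zero:
  assumes "revision_constraints M 0 r" and "i < xdim M" and "t \<in> {1..horizon M}"
  shows "r i t = 0"
proof -
  have mono: "\<forall>s\<in>{1..<horizon M}. r i s \<le> r i (s + 1)"
    and bounds: "r i (horizon M) \<le> 0" "0 \<le> r i t"
    using assms by (auto simp: revision_constraints_def)
  have "t \<le> horizon M" using assms(3) by simp
  then have "r i t \<le> r i (horizon M)"
  proof (induction rule: dec_induct)
    case (step s)
    then have "r i s \<le> r i (s + 1)" using mono assms(3) by auto
    with step.IH show ?case by simp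
  qed simp
  with bounds show ?thesis by simp
qed

lemma two_stage_if_adaptive_constraints:
  assumes inst: "is_msp_instance M" and loc: "local_constraints M (x, y)"
    and adapt: "adaptive_constraints M x r" and rev: "revision_constraints M 0 r"
  shows "two_stage_constraints M x"
  unfolding two_stage_constraints_def
proof (intro ballI)
  fix t m n
  assume t: "t \<in> {1..horizon M}" and mn: "m \<in> stage_nodes M t" "n \<in> stage_nodes M t"
  have tree: "is_scenario_tree M" using inst by (simp add: is_msp_instance_def)
  have nodes: "m \<in> nodes M" "n \<in> nodes M" using mn by (auto simp: stage_nodes_def)
  \<comment> \<open>The adaptive constraints speak only of entries below \<open>xdim M\<close>;
    equality of vectors also needs equal dimensions, which the local sets supply.\<close>
  have "x k \<in> carrier_vec (xdim M)" if "k \<in> nodes M" for k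
    using inst loc that unfolding is_msp_instance_def local_constraints_def by blast
  with nodes have dim: "dim_vec (x m) = xdim M" "dim_vec (x n) = xdim M"
    by auto
  have root: "root M \<in> stage_nodes M 1"
    using tree by (auto simp: is_scenario_tree_def stage_nodes_def)
  have sub: "m \<in> subtree_nodes M (root M)" "n \<in> subtree_nodes M (root M)"
    using root_reaches_node[OF tree] nodes by (auto simp: subtree_nodes_def)
  show "x m = x n"
  proof (rule eq_vecI)
    fix i assume "i < dim_vec (x n)"
    then have i: "i < xdim M" using dim by simp
    \<comment> \<open>Take \<open>l\<close> to be the root, at stage 1: the slack vanishes and the
      two inequalities become an equality.\<close>
    have "1 \<in> {1..horizon M}" using t by simp
    moreover have "r i t = 0" "r i 1 = 0"
      using revision_constraints_zero[OF rev i] t by auto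
    ultimately show "x m $ i = x n $ i"
      using adapt[unfolded adaptive_constraints_def, rule_format, of i 1 t "root M" m n]
        i t root mn sub by auto
  qed (use dim in simp)
qed

lemma adaptive_constraints_if_two_stage:
  assumes "two_stage_constraints M x"
  shows "adaptive_constraints M x (\<lambda>i t. 0)"
  unfolding adaptive_constraints_def
proof (intro allI ballI impI)
  fix i t t' l m n
  assume "t \<in> {1..horizon M}" "t' \<in> {t..horizon M}"
    "m \<in> stage_nodes M t' \<inter> subtree_nodes M l" "n \<in> stage_nodes M t' \<inter> subtree_nodes M l"
  \<comment> \<open>Here 1 \<le> t \<le> t' puts t' in the range of stages to which the two-stage
    constraints apply.\<close>
  then have "x m = x n"
    using assms unfolding two_stage_constraints_def by (metis IntE atLeastAtMost_iff order_trans)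
  then show "x n $ i - xbar M $ i * of_int (0 - 0) \<le> x m $ i \<and>
      x m $ i \<le> x n $ i + xbar M $ i * of_int (0 - 0)"
    by simp
qed

lemma adaptive_constraints_full_revision:
  assumes inst: "is_msp_instance M" and loc: "local_constraints M (x, y)"
  shows "adaptive_constraints M x (\<lambda>i t. int t - 1)"
  unfolding adaptive_constraints_def
proof (intro allI ballI impI)
  fix i t t' l m n
  assume i: "i < xdim M" and tt': "t' \<in> {t..horizon M}" and l: "l \<in> stage_nodes M t"
    and m: "m \<in> stage_nodes M t' \<inter> subtree_nodes M l"
    and n: "n \<in> stage_nodes M t' \<inter> subtree_nodes M l"
  have tree: "is_scenario_tree M" using inst by (simp add: is_msp_instance_def)
  have bounds: "0 \<le> x k $ i" "x k $ i \<le> xbar M $ i" if "k \<in> nodes M" for k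
    using that inst loc i by (auto simp: is_msp_instance_def local_constraints_def)
  have mn: "m \<in> nodes M" "n \<in> nodes M" using m n by (auto simp: stage_nodes_def)
  show "x n $ i - xbar M $ i * of_int (int t' - 1 - (int t - 1)) \<le> x m $ i \<and>
      x m $ i \<le> x n $ i + xbar M $ i * of_int (int t' - 1 - (int t - 1))"
  proof (cases "t' = t")
    case True
    then have "m = l" "n = l"
      using subtree_node_same_stage[OF tree] l m n by (auto simp: stage_nodes_def)
    then show ?thesis using True by simp
  next
    case False
    then have "1 \<le> real_of_int (int t' - 1 - (int t - 1))" using tt' by auto
    \<comment> \<open>The sign of the upper bound is not assumed directly; it follows from the
      bounds on the state at \<open>m\<close>, and is what lets a factor of at least 1 enlarge the
      slack.\<close>
    moreover have "0 \<le> xbar M $ i" using bounds[OF mn(1)] by linarith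
    ultimately have "xbar M $ i \<le> xbar M $ i * of_int (int t' - 1 - (int t - 1))"
      using mult_left_mono by fastforce
    with bounds[OF mn(1)] bounds[OF mn(2)] show ?thesis by linarith
  qed
qed

lemma equivalent_AMS_TSP:
  assumes "is_msp_instance M"
  shows "equivalent (AMS M 0) (TSP M)"
proof -
  have "revision_constraints M 0 (\<lambda>i t. 0)" by (simp add: revision_constraints_def)
  then show ?thesis
    using two_stage_if_adaptive_constraints[OF assms] adaptive_constraints_if_two_stage
    unfolding equivalent_def AMS_def TSP_def by fastforce
qed

lemma equivalent_AMS_MSP:
  assumes "is_msp_instance M"
  shows "equivalent (AMS M (horizon M - 1)) (MSP M)"
proof -
  \<comment> \<open>Excludes truncated subtraction, so that \<open>r i (horizon M)\<close> meets its
    bound with equality.\<close>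
  have "horizon M \<ge> 1" using assms by (simp add: is_msp_instance_def is_scenario_tree_def)
  then have "revision_constraints M (horizon M - 1) (\<lambda>i t. int t - 1)"
    by (auto simp: revision_constraints_def)
  \<comment> \<open>One inclusion merely forgets the constraints involving \<open>r\<close>; the
    other uses the witness above.\<close>
  then show ?thesis
    using adaptive_constraints_full_revision[OF assms]
    unfolding equivalent_def AMS_def MSP_def by fastforce
qed

theorem proposition1:
  fixes M :: "'v msp_instance"
  assumes "is_msp_instance M"
  shows "(equivalent (AMS M 0) (TSP M) \<and>
          optimal_value (AMS M 0) = optimal_value (TSP M)) \<and>
         (equivalent (AMS M (horizon M - 1)) (MSP M) \<and>
          optimal_value (AMS M (horizon M - 1)) = optimal_value (MSP M))"
  using equivalent_AMS_TSP[OF assms] equivalent_AMS_MSP[OF assms]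
  by (simp add: optimal_value_eq_if_equivalent)

end
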